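(* Let $G=(V,E)$ be a connected graph on $n$ vertices with radius $r\geq 1$. Then \[\bar{\mathsf{C}}_C(G)\leq \frac{n-1}{n-1+\binom{r}{2}}.\]
   Context: For vertices $u,v$ of a connected graph $G=(V,E)$ with $|V|=n\ge2$, $d(u,v)$ is the distance between $u$ and $v$. The (normalised) closeness centrality of a vertex $v$ is $\bar{\mathsf{C}}_C(v)=\dfrac{n-1}{\sum_{w\in V}d(v,w)}$, and the closeness centrality of $G$ is $\bar{\mathsf{C}}_C(G)=\dfrac{1}{n}\sum_{v\in V}\bar{\mathsf{C}}_C(v)$. The eccentricity $\epsilon(v)$ of a vertex $v$ is $\max_{u\in V}d(u,v)$, and the radius of $G$ is $r=\min_{v\in V}\epsilon(v)$. *)

theory Defs
  imports Complex_Main "Graph_Theory.Graph_Theory"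
begin

text \<open>
  In a \<^locale>\<open>graph\<close> each undirected edge is represented by its two opposite arcs, so
  arc paths are exactly the paths of the undirected graph. Vertices that no path joins get
  an unspecified distance, so the notions below are meaningful for connected graphs only.
\<close>

context pre_digraph
begin

definition distance :: "'a \<Rightarrow> 'a \<Rightarrow> nat" where
  "distance u v = (LEAST k. \<exists>p. apath u p v \<and> length p = k)"

definition eccentricity :: "'a \<Rightarrow> nat" where
  "eccentricity v = Max ((\<lambda>u. distance u v) ` verts G)"

definition radius :: nat where
  "radius = Min (eccentricity ` verts G)"

definition vertex_closeness :: "'a \<Rightarrow> real" where
  "vertex_closeness v = (real (card (verts G)) - 1) / (\<Sum>w\<in>verts G. real (distance v w))"

definition graph_closeness :: real where
  "graph_closeness = (1 / real (card (verts G))) * (\<Sum>v\<in>verts G. vertex_closeness v)"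

end

lemma (in wf_digraph) distance_eq_\<mu>:
  assumes "u \<rightarrow>\<^sup>* v"
  shows "ereal (real (distance u v)) = \<mu> (\<lambda>_. 1) u v"
proof (rule antisym)
  have cost: "awalk_cost (\<lambda>_. 1) p = real (length p)" for p :: "'b list"
    by (induct p) auto
  have "\<exists>k p. apath u p v \<and> length p = k"
    using assms by (auto simp: reachable_apath)
  then have "\<exists>p. apath u p v \<and> length p = distance u v"
    unfolding distance_def by (rule LeastI_ex)
  then obtain p where "apath u p v" "length p = distance u v" by blast
  then show "\<mu> (\<lambda>_. 1) u v \<le> ereal (real (distance u v))"
    using min_cost_le_walk_cost[of u p v "\<lambda>_. 1"] by (simp add: cost awalkI_apath)
  show "ereal (real (distance u v)) \<le> \<mu> (\<lambda>_. 1) u v"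
    unfolding \<mu>_def
  proof (rule INF_greatest)
    fix p assume "p \<in> {p. awalk u p v}"
    then have "awalk u p v" by simp
    then have "\<exists>q. apath u q v \<and> length q \<le> length p"
    proof (induct rule: awalk_to_apath_induct)
      case (path p)
      then show ?case by (auto simp: apath_def)
    next
      case (decomp p q r s)
      from decomp(2,1,3) have "p = q @ r @ s" by (rule awalk_cyc_decompE)
      with decomp(4) show ?case by fastforce
    qed
    then obtain q where q: "apath u q v" "length q \<le> length p" by blast
    have "distance u v \<le> length q"
      unfolding distance_def using q(1) by (intro Least_le) blast
    with q(2) show "ereal (real (distance u v)) \<le> ereal (awalk_cost (\<lambda>_. 1) p)"
      by (simp add: cost)
  qed
qed

end

theory Submission
  imports Defs
begin

text \<open>
  The bound already holds for the closeness of every single vertex. A vertex \<open>v\<close> has some vertex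
  at distance at least \<open>r\<close>, and a shortest path to it meets every distance \<open>1, \<dots>, r\<close>. Each of
  the \<open>n - 1\<close> vertices other than \<open>v\<close> contributes at least \<open>1\<close> to the sum of distances from
  \<open>v\<close>, and the vertices on this path contribute the additional excess
  \<open>0 + 1 + \<dots> + (r - 1) = r choose 2\<close>.
\<close>

context wf_digraph
begin

text \<open>\<open>distance\<close> ranges over paths only, but it agrees with \<mu> for unit arc
  costs, an infimum over all walks. Walks can thus be cut and spliced without checking that vertices
  stay distinct.\<close>

lemma distance_le_awalk_length:
  assumes "awalk u p v"
  shows "distance u v \<le> length p"
proof -
  have "\<mu> (\<lambda>_. 1) u v \<le> ereal (awalk_cost (\<lambda>_. 1) p)"
    using assms by (rule min_cost_le_walk_cost)
  moreover have "awalk_cost (\<lambda>_. 1) p = real (length p)"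
    by (induct p) auto
  moreover have "ereal (real (distance u v)) = \<mu> (\<lambda>_. 1) u v"
    using assms by (intro distance_eq_\<mu>) (auto simp: reachable_awalk)
  ultimately show ?thesis by (metis ereal_less_eq(3) of_nat_le_iff)
qed

lemma shortest_awalk:
  assumes "u \<rightarrow>\<^sup>* v"
  obtains p where "awalk u p v" "length p = distance u v"
proof -
  have "\<exists>k p. apath u p v \<and> length p = k"
    using assms by (auto simp: reachable_apath)
  then have "\<exists>p. apath u p v \<and> length p = distance u v"
    unfolding distance_def by (rule LeastI_ex)
  then show ?thesis using that by (auto intro: awalkI_apath)
qed

lemma distance_self:
  assumes "v \<in> verts G"
  shows "distance v v = 0"
  using distance_le_awalk_length[of v "[]" v] assms by (simp add: awalk_Nil_iff)

lemma distance_pos: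
  assumes "u \<rightarrow>\<^sup>* v" "u \<noteq> v"
  shows "0 < distance u v"
  using assms by (metis awalk_Nil_iff gr0I length_0_conv shortest_awalk)

text \<open>The vertex reached after \<open>k\<close> arcs of a shortest walk works: a shorter walk
  to it, followed by the remaining arcs, would beat the shortest walk to \<open>v\<close>.\<close>

lemma exists_vertex_at_distance:
  assumes "u \<rightarrow>\<^sup>* v" "k \<le> distance u v"
  shows "\<exists>w\<in>verts G. distance u w = k"
proof -
  obtain p where p: "awalk u p v" "length p = distance u v"
    using assms(1) by (rule shortest_awalk)
  define w where "w = awlast u (take k p)"
  have "awalk u (take k p @ drop k p) v"
    using p(1) by simp
  then have walks: "awalk u (take k p) w" "awalk w (drop k p) v"
    unfolding w_def awalk_append_iff by blast+
  from walks(1) have "u \<rightarrow>\<^sup>* w"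
    by (auto simp: reachable_awalk)
  then obtain q where q: "awalk u q w" "length q = distance u w"
    by (rule shortest_awalk)
  have "awlast u q = w"
    using q(1) by auto
  with q(1) walks(2) have "awalk u (q @ drop k p) v"
    by simp
  then have "distance u v \<le> length (q @ drop k p)"
    by (rule distance_le_awalk_length)
  moreover have "distance u w \<le> length (take k p)"
    using walks(1) by (rule distance_le_awalk_length)
  ultimately have "distance u w = k"
    using p(2) q(2) assms(2) by simp
  moreover have "w \<in> verts G"
    using walks(1) by auto
  ultimately show ?thesis by blast
qed

end

text \<open>Each arc is replaced by an opposite one, in reverse order. The new walk uses other arcs,
  so only its length can be compared.\<close>

lemma (in sym_digraph) awalk_reverse:
  assumes "awalk u p v"
  shows "\<exists>q. awalk v q u \<and> length q = length p"
  using assms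
proof (induction p arbitrary: u)
  case Nil
  then show ?case by (intro exI[of _ "[]"]) (auto simp: awalk_Nil_iff)
next
  case (Cons e p)
  then have e: "e \<in> arcs G" "tail G e = u" and "awalk (head G e) p v"
    by (auto simp: awalk_Cons_iff)
  then obtain q where q: "awalk v q (head G e)" "length q = length p"
    using Cons.IH by blast
  obtain e' where e': "e' \<in> arcs G" "tail G e' = head G e" "head G e' = u"
    using sym_arcs e unfolding symmetric_conv by metis
  have "awlast v q = head G e"
    using q(1) by auto
  moreover have "awalk (head G e) [e'] u"
    using e' by (auto simp: awalk_Cons_iff awalk_Nil_iff)
  ultimately have "awalk v (q @ [e']) u"
    using q(1) by simp
  with q(2) show ?case by (intro exI[of _ "q @ [e']"]) simp
qed

lemma (in sym_digraph) distance_commute: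
  assumes "u \<rightarrow>\<^sup>* v"
  shows "distance u v = distance v u"
proof -
  have "distance b a \<le> distance a b" if "a \<rightarrow>\<^sup>* b" for a b
    using that by (metis awalk_reverse distance_le_awalk_length shortest_awalk)
  then show ?thesis
    using assms symmetric_reachable' by (meson antisym)
qed

lemma sum_diff_one_eq_choose_two: "(\<Sum>i = 1..r. i - 1) = r choose 2"
  by (induction r) (auto simp: numeral_2_eq_2)

lemma (in fin_digraph) sum_distance_ge:
  assumes "strongly_connected G" "v \<in> verts G" "u \<in> verts G" "r \<le> distance v u"
  shows "card (verts G) - 1 + (r choose 2) \<le> (\<Sum>w\<in>verts G. distance v w)"
proof -
  have reach: "v \<rightarrow>\<^sup>* w" if "w \<in> verts G" for w
    using assms(1,2) that by auto
  have "\<exists>w\<in>verts G. distance v w = i" if "i \<in> {1..r}" for i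
    using that assms(3,4) reach by (intro exists_vertex_at_distance[of v u]) auto
  then obtain f where f: "f i \<in> verts G" "distance v (f i) = i" if "i \<in> {1..r}" for i
    by metis
  \<comment> \<open>Removing \<open>v\<close> matters for truncated subtraction: 1 + (d - 1) = d
    fails at d = 0, and \<open>v\<close> is the only vertex at distance 0.\<close>
  let ?W = "verts G - {v}"
  \<comment> \<open>The index \<open>i\<close> is recovered from \<open>f i\<close> as its distance
    from \<open>v\<close>.\<close>
  have "inj_on f {1..r}"
    by (rule inj_onI) (metis f(2))
  then have "(r choose 2) = (\<Sum>w\<in>f ` {1..r}. distance v w - 1)"
    by (simp add: sum.reindex f(2) flip: sum_diff_one_eq_choose_two)
  also have "\<dots> \<le> (\<Sum>w\<in>?W. distance v w - 1)"
  proof (rule sum_mono2)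
    show "f ` {1..r} \<subseteq> ?W"
      using f distance_self[OF assms(2)] by fastforce
  qed auto
  finally have "card ?W + (r choose 2) \<le> (\<Sum>w\<in>?W. 1 + (distance v w - 1))"
    unfolding sum.distrib by simp
  also have "\<dots> = (\<Sum>w\<in>?W. distance v w)"
    using distance_pos reach by (intro sum.cong) fastforce+
  also have "\<dots> \<le> (\<Sum>w\<in>verts G. distance v w)"
    by (rule sum_mono2) auto
  finally show ?thesis
    using assms(2) by simp
qed

lemma (in pseudo_graph) exists_distance_ge_radius:
  assumes "strongly_connected G" "v \<in> verts G"
  shows "\<exists>u\<in>verts G. radius \<le> distance v u"
proof -
  have "radius \<le> eccentricity v"
    unfolding radius_def using assms(2) by (intro Min_le) auto
  moreover have "eccentricity v \<in> (\<lambda>u. distance u v) ` verts G"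
    unfolding eccentricity_def using assms(2) by (intro Max_in) auto
  ultimately obtain u where "u \<in> verts G" "radius \<le> distance u v"
    by auto
  \<comment> \<open>Eccentricity measures distances towards \<open>v\<close>, closeness distances
    from \<open>v\<close>; symmetry reconciles them.\<close>
  moreover from this have "distance u v = distance v u"
    using assms by (intro distance_commute) auto
  ultimately show ?thesis by auto
qed

lemma (in pseudo_graph) vertex_closeness_le:
  assumes "strongly_connected G" "v \<in> verts G"
  shows "vertex_closeness v
    \<le> (real (card (verts G)) - 1) / (real (card (verts G)) - 1 + real (radius choose 2))"
proof (cases "card (verts G) = 1")
  \<comment> \<open>With a single vertex both numerators are 0, so both sides vanish whatever the
    denominators are. Otherwise n - 1 > 0 makes both denominators positive.\<close>
  case True
  then show ?thesis by (simp add: vertex_closeness_def)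
next
  case False
  moreover have "card (verts G) > 0"
    using assms(2) by (auto simp: card_gt_0_iff)
  ultimately have n: "card (verts G) > 1" by simp
  obtain u where "u \<in> verts G" "radius \<le> distance v u"
    using exists_distance_ge_radius[OF assms] by blast
  then have "card (verts G) - 1 + (radius choose 2) \<le> (\<Sum>w\<in>verts G. distance v w)"
    by (rule sum_distance_ge[OF assms])
  then have "real (card (verts G) - 1 + (radius choose 2))
      \<le> real (\<Sum>w\<in>verts G. distance v w)"
    by (simp only: of_nat_le_iff)
  then have "real (card (verts G)) - 1 + real (radius choose 2)
      \<le> (\<Sum>w\<in>verts G. real (distance v w))"
    using n by (simp add: of_nat_diff)
  then show ?thesis
    unfolding vertex_closeness_def using n by (intro divide_left_mono mult_pos_pos) auto
qed

theorem theorem6: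
  fixes G :: "('a, 'b) pre_digraph" and n r :: nat
  assumes "graph G"
    and "Digraph_Component.connected G"
    and "n = card (verts G)"
    and "r = pre_digraph.radius G"
    and "r \<ge> 1"
  shows "pre_digraph.graph_closeness G \<le> (real n - 1) / (real n - 1 + real (r choose 2))"
proof -
  interpret graph G by fact
  have sc: "strongly_connected G"
    using sym_arcs assms(2) by (rule symmetric_connected_imp_strongly_connected)
  then have "n > 0"
    unfolding assms(3) strongly_connected_def by (auto simp: card_gt_0_iff)
  \<comment> \<open>The bound on the closeness of a vertex is the same for all vertices, so it
    passes to their average.\<close>
  have "(\<Sum>v\<in>verts G. vertex_closeness v)
      \<le> real n * ((real n - 1) / (real n - 1 + real (r choose 2)))"
    unfolding assms(3,4) using vertex_closeness_le[OF sc] by (rule sum_bounded_above)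
  then show ?thesis
    unfolding graph_closeness_def using \<open>n > 0\<close> assms(3) by (simp add: field_simps)
qed

end
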